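(* The only solution of the diophantine equation $D_2(n)=p^k$ with $p$ a prime number and $n,k$ positive integers is $(p,n,k)=(2,2,1)$.
   Context: For integers $n\ge 0$, the $2$-derangement number $D_2(n)$ is the number of permutations of $\{1,\dots,n+2\}$ that have no fixed points and in whose cycle decomposition the elements $1$ and $2$ lie in distinct cycles. *)

theory Defs
  imports Main "HOL-Combinatorics.Combinatorics" "HOL-Computational_Algebra.Primes"
begin

text \<open>
  For a permutation \<open>\<pi>\<close> of a finite set, \<open>orbit \<pi> x\<close> is the set of elements of the cycle of
  \<open>\<pi>\<close> containing \<open>x\<close>; so \<open>1\<close> and \<open>2\<close> lie in distinct cycles iff their orbits differ.
\<close>

definition two_derangements :: "nat \<Rightarrow> (nat \<Rightarrow> nat) set" where
  "two_derangements n =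
    {\<pi>. \<pi> permutes {1..n + 2} \<and> (\<forall>i\<in>{1..n + 2}. \<pi> i \<noteq> i) \<and> orbit \<pi> 1 \<noteq> orbit \<pi> 2}"

definition D2 :: "nat \<Rightarrow> nat" where
  "D2 n = card (two_derangements n)"

end

theory Submission
  imports Defs
begin

text \<open>
  Write \<open>(a, b) = (\<pi> 1, \<pi> 2)\<close>. Since \<open>\<pi>\<close> has no fixed points and separates \<open>1\<close> and \<open>2\<close>,
  this is a pair of distinct elements of \<open>{3..n + 2}\<close>. Conjugation by permutations that fix
  \<open>1\<close> and \<open>2\<close> shows that all \<open>n (n - 1)\<close> such pairs occur equally often. So \<open>n (n - 1)\<close> divides
  \<open>D2 n\<close>, and as \<open>n\<close> and \<open>n - 1\<close> are coprime, \<open>D2 n\<close> can only be a prime power if \<open>n = 2\<close>.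
\<close>

definition two_derangements_at :: "nat \<Rightarrow> nat \<times> nat \<Rightarrow> (nat \<Rightarrow> nat) set" where
  "two_derangements_at n ab = {\<pi> \<in> two_derangements n. (\<pi> 1, \<pi> 2) = ab}"

lemma finite_two_derangements: "finite (two_derangements n)"
  by (rule finite_subset[OF _ finite_permutations[of "{1..n + 2}"]])
    (auto simp: two_derangements_def)

text \<open>Conjugation turns each step \<open>z\<close> to \<open>\<pi> z\<close> into a step
  \<open>\<sigma> z\<close> to \<open>\<sigma> (\<pi> z)\<close>, so induction along the orbit gives
  either inclusion.\<close>

lemma orbit_conjugate:
  assumes "bij \<sigma>"
  shows "orbit (\<sigma> \<circ> \<pi> \<circ> inv \<sigma>) (\<sigma> x) = \<sigma> ` orbit \<pi> x" (is "orbit ?\<rho> _ = _")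
proof (intro equalityI subsetI)
  have conj: "?\<rho> (\<sigma> z) = \<sigma> (\<pi> z)" for z
    using assms by (simp add: bij_is_inj)
  show "y \<in> \<sigma> ` orbit \<pi> x" if "y \<in> orbit ?\<rho> (\<sigma> x)" for y
    using that
  proof induction
    case base
    show ?case
      unfolding conj by (intro imageI orbit.base)
  next
    case (step y)
    then obtain z where "y = \<sigma> z" "z \<in> orbit \<pi> x"
      by blast
    then show ?case
      unfolding \<open>y = \<sigma> z\<close> conj by (intro imageI orbit.step)
  qed
  have "\<sigma> z \<in> orbit ?\<rho> (\<sigma> x)" if "z \<in> orbit \<pi> x" for z
    using that
  proof induction
    case base
    show ?case
      using orbit.base[of ?\<rho> "\<sigma> x"] unfolding conj .
  next
    case (step z)
    then show ?case
      using orbit.step[of "\<sigma> z" ?\<rho> "\<sigma> x"] unfolding conj by blast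
  qed
  then show "y \<in> orbit ?\<rho> (\<sigma> x)" if "y \<in> \<sigma> ` orbit \<pi> x" for y
    using that by blast
qed

text \<open>A permutation of a finite set has only cyclic orbits, so moving along a cycle does not
  change it. This turns the condition on the cycles of \<open>1\<close> and \<open>2\<close> into
  restrictions on single values of \<open>\<pi>\<close>.\<close>

lemma two_derangements_orbit_apply:
  assumes "\<pi> \<in> two_derangements n"
  shows "orbit \<pi> (\<pi> x) = orbit \<pi> x"
proof (rule orbit_cyclic_eq3)
  have "\<pi> permutes {1..n + 2}"
    using assms by (simp add: two_derangements_def)
  then show "cyclic_on \<pi> (orbit \<pi> x)"
    by (rule cyclic_on_orbit) simp
qed (rule orbit.base)

text \<open>Conjugation relabels the cycles by \<open>\<sigma>\<close>. Since
  \<open>\<sigma>\<close> moves only elements from \<open>3\<close> on, the labels \<open>1\<close>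
  and \<open>2\<close> stay in place and their cycles stay distinct.\<close>

lemma conjugate_two_derangements:
  assumes \<sigma>: "\<sigma> permutes {3..n + 2}" and \<pi>: "\<pi> \<in> two_derangements n"
  shows "\<sigma> \<circ> \<pi> \<circ> inv \<sigma> \<in> two_derangements n"
proof -
  have bij: "bij \<sigma>" and fix12: "\<sigma> 1 = 1" "\<sigma> 2 = 2"
    using \<sigma> by (auto simp: permutes_bij permutes_not_in)
  have \<sigma>': "\<sigma> permutes {1..n + 2}"
    using \<sigma> by (rule permutes_subset) auto
  have perm: "\<sigma> \<circ> \<pi> \<circ> inv \<sigma> permutes {1..n + 2}"
    using \<pi> \<sigma>' by (auto simp: two_derangements_def intro!: permutes_compose permutes_inv)
  have "(\<sigma> \<circ> \<pi> \<circ> inv \<sigma>) i \<noteq> i" if "i \<in> {1..n + 2}" for i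
  proof
    assume "(\<sigma> \<circ> \<pi> \<circ> inv \<sigma>) i = i"
    then have "\<pi> (inv \<sigma> i) = inv \<sigma> i"
      using \<sigma> by (metis comp_apply permutes_inverses(2))
    moreover have "inv \<sigma> i \<in> {1..n + 2}"
      using that permutes_in_image[OF permutes_inv[OF \<sigma>']] by blast
    ultimately show False
      using \<pi> by (auto simp: two_derangements_def)
  qed
  moreover have "orbit (\<sigma> \<circ> \<pi> \<circ> inv \<sigma>) 1 \<noteq> orbit (\<sigma> \<circ> \<pi> \<circ> inv \<sigma>) 2"
  proof -
    have "\<sigma> ` orbit \<pi> 1 \<noteq> \<sigma> ` orbit \<pi> 2"
      using \<pi> bij by (simp add: inj_image_eq_iff bij_is_inj two_derangements_def)
    then show ?thesis
      using orbit_conjugate[OF bij] fix12 by metis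
  qed
  ultimately show ?thesis
    using perm by (simp add: two_derangements_def)
qed

text \<open>Double transitivity of the symmetric group: one transposition takes \<open>a\<close> to
  \<open>c\<close>, and a second takes the image of \<open>b\<close> to \<open>d\<close>. The second
  leaves \<open>c\<close> alone because neither that image nor \<open>d\<close> equals
  \<open>c\<close>.\<close>

lemma permutes_pair_exists:
  assumes "a \<in> S" "b \<in> S" "c \<in> S" "d \<in> S" "a \<noteq> b" "c \<noteq> d"
  obtains \<sigma> where "\<sigma> permutes S" "\<sigma> a = c" "\<sigma> b = d"
proof
  let ?\<tau> = "transpose a c"
  have b: "?\<tau> b \<in> S" "?\<tau> b \<noteq> c"
    using assms by (auto simp: transpose_def)
  show "transpose (?\<tau> b) d \<circ> ?\<tau> permutes S"
    using assms b by (intro permutes_compose permutes_swap_id) auto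
  show "(transpose (?\<tau> b) d \<circ> ?\<tau>) a = c" "(transpose (?\<tau> b) d \<circ> ?\<tau>) b = d"
    using assms b by (auto simp: transpose_apply_other)
qed

definition distinct_pairs :: "nat \<Rightarrow> (nat \<times> nat) set" where
  "distinct_pairs n = (SIGMA a:{3..n + 2}. {3..n + 2} - {a})"

lemma card_distinct_pairs: "card (distinct_pairs n) = n * (n - 1)"
  by (simp add: distinct_pairs_def)

text \<open>Conjugation by some \<open>\<sigma>\<close> that takes the pair \<open>ab\<close> to
  \<open>cd\<close> is an injection between the two sets. As the pairs are arbitrary, exchanging
  them yields equality.\<close>

lemma card_two_derangements_at_le:
  assumes "ab \<in> distinct_pairs n" "cd \<in> distinct_pairs n"
  shows "card (two_derangements_at n ab) \<le> card (two_derangements_at n cd)"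
proof -
  obtain \<sigma> where \<sigma>: "\<sigma> permutes {3..n + 2}" "\<sigma> (fst ab) = fst cd" "\<sigma> (snd ab) = snd cd"
    by (rule permutes_pair_exists[of "fst ab" "{3..n + 2}" "snd ab" "fst cd" "snd cd"])
      (use assms in \<open>auto simp: distinct_pairs_def\<close>)
  have bij: "bij \<sigma>" and fix12: "inv \<sigma> 1 = 1" "inv \<sigma> 2 = 2"
    using \<sigma>(1) permutes_inv[OF \<sigma>(1)] by (auto simp: permutes_bij permutes_not_in)
  show ?thesis
  proof (rule card_inj_on_le)
    show "inj_on (\<lambda>\<pi>. \<sigma> \<circ> \<pi> \<circ> inv \<sigma>) (two_derangements_at n ab)"
    proof (rule inj_onI)
      fix \<pi> \<rho>
      assume "\<sigma> \<circ> \<pi> \<circ> inv \<sigma> = \<sigma> \<circ> \<rho> \<circ> inv \<sigma>"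
      then have "\<sigma> (\<pi> x) = \<sigma> (\<rho> x)" for x
        using bij by (metis bij_inv_eq_iff comp_apply)
      then show "\<pi> = \<rho>"
        using bij by (metis bij_is_inj ext injD)
    qed
    show "(\<lambda>\<pi>. \<sigma> \<circ> \<pi> \<circ> inv \<sigma>) ` two_derangements_at n ab \<subseteq> two_derangements_at n cd"
      using conjugate_two_derangements[OF \<sigma>(1)] \<sigma> fix12
      by (auto simp: two_derangements_at_def)
    show "finite (two_derangements_at n cd)"
      by (simp add: two_derangements_at_def finite_two_derangements)
  qed
qed

lemma two_derangements_image_pair:
  assumes "\<pi> \<in> two_derangements n"
  shows "(\<pi> 1, \<pi> 2) \<in> distinct_pairs n"
proof -
  have perm: "\<pi> permutes {1..n + 2}" and ne: "\<pi> 1 \<noteq> 1" "\<pi> 2 \<noteq> 2"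
    and orb: "orbit \<pi> 1 \<noteq> orbit \<pi> 2"
    using assms by (auto simp: two_derangements_def)
  note eq = two_derangements_orbit_apply[OF assms]
  have "\<pi> 1 \<in> {1..n + 2}" "\<pi> 2 \<in> {1..n + 2}"
    using permutes_in_image[OF perm] by auto
  \<comment> \<open>Otherwise \<open>1\<close> and \<open>2\<close> would share a cycle.\<close>
  moreover have "\<pi> 1 \<noteq> 2" "\<pi> 2 \<noteq> 1"
    using eq[of 1] eq[of 2] orb by auto
  moreover have "\<pi> 1 \<noteq> \<pi> 2"
    using permutes_inj[OF perm] by (simp add: inj_eq)
  ultimately show ?thesis
    using ne by (auto simp: distinct_pairs_def)
qed

text \<open>The values at \<open>1\<close> and \<open>2\<close> partition the 2-derangements into
  classes indexed by \<open>distinct_pairs n\<close>, and all classes have the size of the one at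
  \<open>ab\<close>.\<close>

lemma D2_eq:
  assumes ab: "ab \<in> distinct_pairs n"
  shows "D2 n = n * (n - 1) * card (two_derangements_at n ab)"
proof -
  have "D2 n = (\<Sum>cd\<in>distinct_pairs n. card (two_derangements_at n cd))"
    unfolding D2_def card_eq_sum two_derangements_at_def
    by (rule sum.group[symmetric])
      (use two_derangements_image_pair finite_two_derangements
        in \<open>auto simp: distinct_pairs_def\<close>)
  also have "\<dots> = (\<Sum>cd\<in>distinct_pairs n. card (two_derangements_at n ab))"
    by (intro sum.cong refl antisym card_two_derangements_at_le ab)
  finally show ?thesis
    by (simp add: card_distinct_pairs)
qed

lemma dvd_D2: "n * (n - 1) dvd D2 n"
\<comment> \<open>For \<open>n \<le> 1\<close> there is no pair to feed into \<open>D2_eq\<close>,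
  but then \<open>D2 n\<close> vanishes.\<close>
proof (cases "distinct_pairs n = {}")
  case True
  then have "two_derangements n = {}"
    using two_derangements_image_pair[of _ n] by auto
  then have "D2 n = 0"
    by (simp add: D2_def)
  then show ?thesis by simp
next
  case False
  then show ?thesis
    using D2_eq by (metis dvd_triv_left ex_in_conv)
qed

lemma two_derangements_at_2:
  "two_derangements_at 2 (3, 4) = {transpose 1 3 \<circ> transpose 2 4}" (is "_ = {?\<tau>}")
proof (intro equalityI subsetI)
  fix \<pi> assume *: "\<pi> \<in> two_derangements_at 2 (3, 4)"
  then have \<pi>: "\<pi> \<in> two_derangements 2" "\<pi> 1 = 3" "\<pi> 2 = 4"
    by (auto simp: two_derangements_at_def)
  have perm: "\<pi> permutes {1..4}" and ne: "\<pi> 3 \<noteq> 3" "\<pi> 4 \<noteq> 4"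
    and orb: "orbit \<pi> 1 \<noteq> orbit \<pi> 2"
    using \<pi>(1) by (auto simp: two_derangements_def)
  note eq = two_derangements_orbit_apply[OF \<pi>(1)]
  have inj: "\<pi> x = \<pi> y \<longleftrightarrow> x = y" for x y
    using permutes_inj[OF perm] by (simp add: inj_eq)
  have "\<pi> 3 \<in> {1..4}" "\<pi> 4 \<in> {1..4}"
    using permutes_in_image[OF perm] by auto
  \<comment> \<open>\<open>3\<close> lies in the cycle of \<open>1\<close> and \<open>4\<close> in
    that of \<open>2\<close>; either value would merge these cycles.\<close>
  moreover have "\<pi> 3 \<noteq> 2" "\<pi> 4 \<noteq> 1"
    using eq[of 1] eq[of 2] eq[of 3] eq[of 4] orb \<pi> by auto
  moreover have "\<pi> 3 \<noteq> 4" "\<pi> 4 \<noteq> 3"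
    using inj[of 3 2] inj[of 4 1] \<pi> by auto
  ultimately have "\<pi> 3 = 1" "\<pi> 4 = 2"
    using ne by auto
  moreover have "\<pi> x = x" if "x \<notin> {1, 2, 3, 4}" for x
    using permutes_not_in[OF perm, of x] that by auto
  ultimately have "\<pi> x = ?\<tau> x" for x
    using \<pi>(2,3) by (cases "x \<in> {1, 2, 3, 4}") (auto simp: transpose_def)
  then show "\<pi> \<in> {?\<tau>}" by auto
next
  fix \<pi> assume "\<pi> \<in> {?\<tau>}"
  moreover have "?\<tau> permutes {1..4}"
    by (intro permutes_compose permutes_swap_id) auto
  moreover have "?\<tau> i \<noteq> i" if "i \<in> {1..4}" for i
  proof -
    have "i = 1 \<or> i = 2 \<or> i = 3 \<or> i = 4" using that by auto
    then show ?thesis by (auto simp: transpose_def)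
  qed
  moreover have "orbit ?\<tau> 1 \<noteq> orbit ?\<tau> 2"
  proof -
    \<comment> \<open>The set \<open>{1, 3}\<close> is invariant, so the orbit of \<open>1\<close>
      misses \<open>4\<close>, which lies in the orbit of \<open>2\<close>.\<close>
    have "y \<in> {1, 3}" if "y \<in> orbit ?\<tau> 1" for y
      using that by induction (auto simp: transpose_def)
    moreover have "4 \<in> orbit ?\<tau> 2"
      using orbit.base[of ?\<tau> 2] by (simp add: transpose_def)
    ultimately show ?thesis by force
  qed
  ultimately show "\<pi> \<in> two_derangements_at 2 (3, 4)"
    by (auto simp: two_derangements_at_def two_derangements_def transpose_def)
qed

lemma D2_2: "D2 2 = 2"
  using D2_eq[of "(3, 4)" 2] unfolding two_derangements_at_2
  by (simp add: distinct_pairs_def)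

text \<open>Both factors are powers of \<open>p\<close>, yet they are coprime, so the smaller one
  must be \<open>1\<close>.\<close>

lemma pronic_dvd_prime_power:
  fixes p n k :: nat
  assumes "prime p" "n > 0" "n * (n - 1) dvd p ^ k"
  shows "n = 2"
proof -
  \<comment> \<open>For \<open>n = 1\<close> the product is \<open>0\<close>, which divides no power
    of a prime.\<close>
  have n: "n > 1"
    using assms by (cases "n = 1") (auto simp: prime_gt_0_nat)
  have "n dvd p ^ k" "n - 1 dvd p ^ k"
    using assms(3) by (auto dest: dvd_mult_left dvd_mult_right)
  then obtain i j where ij: "n = p ^ i" "n - 1 = p ^ j"
    using assms(1) by (auto simp: divides_primepow_nat)
  have "coprime n (n - 1)"
    by (rule coprime_diff_one_right_nat) (use n in simp)
  then have "coprime (p ^ i) (p ^ j)"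
    using ij by metis
  moreover have "i > 0"
    using ij(1) n by (cases i) auto
  ultimately have "j = 0"
    using prime_gt_1_nat[OF assms(1)] by auto
  then show ?thesis
    using ij(2) n by simp
qed

theorem theorem19:
  fixes p n k :: nat
  assumes "prime p" and "n > 0" and "k > 0"
  shows "D2 n = p ^ k \<longleftrightarrow> (p, n, k) = (2, 2, 1)"
proof
  assume eq: "D2 n = p ^ k"
  have n: "n = 2"
    using pronic_dvd_prime_power[OF assms(1,2)] dvd_D2[of n] eq by simp
  then have 2: "p ^ k = 2"
    using eq D2_2 by simp
  \<comment> \<open>Positivity of \<open>k\<close> enters here: it makes \<open>p\<close> a divisor
    of \<open>p ^ k\<close>.\<close>
  then have "p dvd 2"
    using assms(3) by (metis dvd_power)
  then have p: "p = 2"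
    using assms(1) by (simp add: primes_dvd_imp_eq)
  then have "k = 1"
    using 2 power_inject_exp[of "2::nat" k 1] by simp
  with p n show "(p, n, k) = (2, 2, 1)" by simp
qed (use D2_2 in auto)

end
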